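(* Let $\lambda\in\mathbb{C}^{\times}$, $a,b\in\mathbb{C}$ and $\beta_1(\overline{h})\in\mathbb{C}[\overline{h}]$, and likewise $\lambda'\in\mathbb{C}^{\times}$, $a',b'\in\mathbb{C}$, $\beta_1'(\overline{h})\in\mathbb{C}[\overline{h}]$. Then: (i) The $\mathfrak{g}$-modules $\Gamma(\lambda,a,b)$ and $\Theta(\lambda,a,b)$ are simple. We have $\Gamma(\lambda,a,b)\cong\Gamma(\lambda',a',b')$ if and only if $\lambda=\lambda'$, $a=a'$ and $b=b'$. Similarly, $\Theta(\lambda,a,b)\cong\Theta(\lambda',a',b')$ if and only if $\lambda=\lambda'$, $a=a'$ and $b=b'$. (ii) The $\mathfrak{g}$-module $\Omega(\lambda,b,\beta_1(\overline{h}))$ is simple if and only if $b\neq 0$. We have $\Omega(\lambda,b,\beta_1(\overline{h}))\cong\Omega(\lambda',b',\beta_1'(\overline{h}))$ if and only if $\lambda=\lambda'$, $b=b'$ and $\beta_1(\overline{h})=\beta_1'(\overline{h})$.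
   Context: All vector spaces and algebras are over $\mathbb{C}$; $\mathbb{C}^\times=\mathbb{C}\setminus\{0\}$. $\mathfrak{g}=\mathfrak{sl}_2\otimes_{\mathbb{C}}\mathbb{C}[t]/(t^2)$ is the Takiff Lie algebra for $\mathfrak{sl}_2$, with $[x\otimes t^i,y\otimes t^j]=[x,y]\otimes t^{i+j}$. With the standard basis $e,h,f$ of $\mathfrak{sl}_2$ ($[e,f]=h$, $[h,e]=2e$, $[h,f]=-2f$), identify $x$ with $x\otimes 1$ and put $\overline{x}=x\otimes t$ for $x\in\{e,h,f\}$. Write $\overline{\partial}=\partial/\partial\overline{h}$ on $\mathbb{C}[h,\overline{h}]$. The following $\mathfrak{g}$-modules all have underlying space $\mathbb{C}[h,\overline{h}]$, with $h$ and $\overline{h}$ acting by multiplication, and for $\gamma=\gamma(h,\overline{h})\in\mathbb{C}[h,\overline{h}]$: $\Gamma(\lambda,a,b)$: $e\cdot\gamma=-2\lambda\,\overline{\partial}(\gamma(h-2,\overline{h}))$, $\overline{e}\cdot\gamma=\lambda\gamma(h-2,\overline{h})$, $\overline{f}\cdot\gamma=-\frac{1}{4\lambda}(\overline{h}^2+a)\gamma(h+2,\overline{h})$, $f\cdot\gamma=-\frac{1}{2\lambda}((h+2)\overline{h}+b)\gamma(h+2,\overline{h})-\frac{1}{2\lambda}(\overline{h}^2+a)\overline{\partial}(\gamma(h+2,\overline{h}))$. $\Theta(\lambda,a,b)$: $f\cdot\gamma=2\lambda\,\overline{\partial}(\gamma(h+2,\overline{h}))$, $\overline{f}\cdot\gamma=\lambda\gamma(h+2,\overline{h})$,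 $\overline{e}\cdot\gamma=-\frac{1}{4\lambda}(\overline{h}^2+a)\gamma(h-2,\overline{h})$, $e\cdot\gamma=-\frac{1}{2\lambda}((h-2)\overline{h}+b)\gamma(h-2,\overline{h})+\frac{1}{2\lambda}(\overline{h}^2+a)\overline{\partial}(\gamma(h-2,\overline{h}))$. $\Omega(\lambda,b,\beta_1(\overline{h}))$: $e\cdot\gamma=(\frac{\lambda}{2}h+\alpha_1(\overline{h}))\gamma(h-2,\overline{h})-\lambda(\overline{h}+b)\overline{\partial}(\gamma(h-2,\overline{h}))$, $f\cdot\gamma=-(\frac{1}{2\lambda}h-\beta_1(\overline{h}))\gamma(h+2,\overline{h})-\frac{1}{\lambda}(\overline{h}-b)\overline{\partial}(\gamma(h+2,\overline{h}))$, $\overline{e}\cdot\gamma=\frac{\lambda}{2}(\overline{h}+b)\gamma(h-2,\overline{h})$, $\overline{f}\cdot\gamma=-\frac{1}{2\lambda}(\overline{h}-b)\gamma(h+2,\overline{h})$, where, writing $\beta_1(\overline{h})=\sum_{i=0}^m q_i\overline{h}^i$, the polynomial $\alpha_1(\overline{h})=\sum_{i=0}^m p_i\overline{h}^i$ is determined by $p_i=\lambda^2\big(q_i+\sum_{j=i+1}^{m}2b^{\,j-i}q_j\big)$ for $0\le i\le m$. *)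

theory Defs
  imports "HOL-Analysis.Analysis" "HOL-Computational_Algebra.Polynomial"
begin

section \<open>Lie algebras and their modules\<close>

locale lie_algebra = vector_space scale
  for scale :: "'k::field \<Rightarrow> 'g::ab_group_add \<Rightarrow> 'g" +
  fixes bracket :: "'g \<Rightarrow> 'g \<Rightarrow> 'g"
  assumes bracket_linear_left: "Vector_Spaces.linear scale scale (\<lambda>x. bracket x y)"
    and bracket_linear_right: "Vector_Spaces.linear scale scale (bracket x)"
    and bracket_self: "bracket x x = 0"
    and jacobi: "bracket x (bracket y z) + bracket y (bracket z x) + bracket z (bracket x y) = 0"

locale lie_module = lie_algebra gscale bracket + V: vector_space vscale
  for gscale :: "'k::field \<Rightarrow> 'g::ab_group_add \<Rightarrow> 'g"
    and bracket :: "'g \<Rightarrow> 'g \<Rightarrow> 'g"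
    and vscale :: "'k \<Rightarrow> 'v::ab_group_add \<Rightarrow> 'v" +
  fixes act :: "'g \<Rightarrow> 'v \<Rightarrow> 'v"
  assumes act_linear_left: "Vector_Spaces.linear gscale vscale (\<lambda>x. act x v)"
    and act_linear_right: "Vector_Spaces.linear vscale vscale (act x)"
    and act_bracket: "act (bracket x y) v = act x (act y v) - act y (act x v)"

definition lie_submodule ::
    "('k::field \<Rightarrow> 'v::ab_group_add \<Rightarrow> 'v) \<Rightarrow> ('g \<Rightarrow> 'v \<Rightarrow> 'v) \<Rightarrow> 'v set \<Rightarrow> bool"
  where "lie_submodule vscale act W \<longleftrightarrow>
    module.subspace vscale W \<and> (\<forall>x. \<forall>w\<in>W. act x w \<in> W)"

definition simple_lie_module ::
    "('k::field \<Rightarrow> 'g::ab_group_add \<Rightarrow> 'g) \<Rightarrow> ('g \<Rightarrow> 'g \<Rightarrow> 'g) \<Rightarrow>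
     ('k \<Rightarrow> 'v::ab_group_add \<Rightarrow> 'v) \<Rightarrow> ('g \<Rightarrow> 'v \<Rightarrow> 'v) \<Rightarrow> bool"
  where "simple_lie_module gscale bracket vscale act \<longleftrightarrow>
    lie_module gscale bracket vscale act \<and> (\<exists>v::'v. v \<noteq> 0) \<and>
    (\<forall>W. lie_submodule vscale act W \<longrightarrow> W = {0} \<or> W = UNIV)"

definition isomorphic_lie_modules ::
    "('k::field \<Rightarrow> 'g::ab_group_add \<Rightarrow> 'g) \<Rightarrow> ('g \<Rightarrow> 'g \<Rightarrow> 'g) \<Rightarrow>
     ('k \<Rightarrow> 'v::ab_group_add \<Rightarrow> 'v) \<Rightarrow> ('g \<Rightarrow> 'v \<Rightarrow> 'v) \<Rightarrow>
     ('k \<Rightarrow> 'w::ab_group_add \<Rightarrow> 'w) \<Rightarrow> ('g \<Rightarrow> 'w \<Rightarrow> 'w) \<Rightarrow> bool"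
  where "isomorphic_lie_modules gscale bracket vscale act vscale' act' \<longleftrightarrow>
    lie_module gscale bracket vscale act \<and> lie_module gscale bracket vscale' act' \<and>
    (\<exists>\<phi>. Vector_Spaces.linear vscale vscale' \<phi> \<and> bij \<phi> \<and>
      (\<forall>x v. \<phi> (act x v) = act' x (\<phi> v)))"


section \<open>The Lie algebra \<open>sl\<^sub>2\<close>\<close>

typedef sl2 = "{A :: complex^2^2. trace A = 0}"
  morphisms mat_of_sl2 Abs_sl2
  by (rule exI[of _ 0]) (simp add: trace_def)

setup_lifting type_definition_sl2

instantiation sl2 :: ab_group_add
begin

lift_definition zero_sl2 :: sl2 is 0
  by (simp add: trace_def)

lift_definition plus_sl2 :: "sl2 \<Rightarrow> sl2 \<Rightarrow> sl2" is "(+)"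
  by (simp add: trace_add)

lift_definition minus_sl2 :: "sl2 \<Rightarrow> sl2 \<Rightarrow> sl2" is "(-)"
  by (simp add: trace_sub)

lift_definition uminus_sl2 :: "sl2 \<Rightarrow> sl2" is uminus
  by (simp add: trace_def sum_negf)

instance
  by standard (transfer; simp)+

end

lift_definition sl2_scale :: "complex \<Rightarrow> sl2 \<Rightarrow> sl2" is "\<lambda>c A. \<chi> i j. c * A $ i $ j"
  by (simp add: trace_def sum_2 flip: distrib_left)

lift_definition sl2_bracket :: "sl2 \<Rightarrow> sl2 \<Rightarrow> sl2" is "\<lambda>A B. A ** B - B ** A"
  by (subst trace_sub, subst trace_mul_sym, simp)

lift_definition sl2_e :: sl2 is "vector [vector [0, 1], vector [0, 0]]"
  by (simp add: trace_def sum_2)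

lift_definition sl2_h :: sl2 is "vector [vector [1, 0], vector [0, -1]]"
  by (simp add: trace_def sum_2)

lift_definition sl2_f :: sl2 is "vector [vector [0, 0], vector [1, 0]]"
  by (simp add: trace_def sum_2)

lift_definition coord_e :: "sl2 \<Rightarrow> complex" is "\<lambda>A. A $ 1 $ 2" .
lift_definition coord_h :: "sl2 \<Rightarrow> complex" is "\<lambda>A. A $ 1 $ 1" .
lift_definition coord_f :: "sl2 \<Rightarrow> complex" is "\<lambda>A. A $ 2 $ 1" .

lemma sl2_eq_iff:
  "x = y \<longleftrightarrow> coord_e x = coord_e y \<and> coord_h x = coord_h y \<and> coord_f x = coord_f y"
  by transfer (auto simp: trace_def vec_eq_iff sum_2 forall_2 add_eq_0_iff)

lemma coord_simps [simp]:
  "coord_e 0 = 0" "coord_h 0 = 0" "coord_f 0 = 0"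
  "coord_e (x + y) = coord_e x + coord_e y"
  "coord_h (x + y) = coord_h x + coord_h y"
  "coord_f (x + y) = coord_f x + coord_f y"
  "coord_e (sl2_scale c x) = c * coord_e x"
  "coord_h (sl2_scale c x) = c * coord_h x"
  "coord_f (sl2_scale c x) = c * coord_f x"
  "coord_e sl2_e = 1" "coord_h sl2_e = 0" "coord_f sl2_e = 0"
  "coord_e sl2_h = 0" "coord_h sl2_h = 1" "coord_f sl2_h = 0"
  "coord_e sl2_f = 0" "coord_h sl2_f = 0" "coord_f sl2_f = 1"
  by (transfer; simp)+

lemma sl2_basis_expansion:
  "x = sl2_scale (coord_e x) sl2_e + sl2_scale (coord_h x) sl2_h + sl2_scale (coord_f x) sl2_f"
  by (simp add: sl2_eq_iff)

lemma coord_bracket [simp]: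
  "coord_e (sl2_bracket x y) = 2 * (coord_h x * coord_e y - coord_e x * coord_h y)"
  "coord_h (sl2_bracket x y) = coord_e x * coord_f y - coord_f x * coord_e y"
  "coord_f (sl2_bracket x y) = 2 * (coord_f x * coord_h y - coord_h x * coord_f y)"
  by (transfer; simp add: matrix_matrix_mult_def trace_def sum_2 add_eq_0_iff algebra_simps)+

lemma sl2_bracket_basis:
  "sl2_bracket sl2_e sl2_f = sl2_h"
  "sl2_bracket sl2_h sl2_e = sl2_scale 2 sl2_e"
  "sl2_bracket sl2_h sl2_f = sl2_scale (-2) sl2_f"
  by (simp_all add: sl2_eq_iff)


section \<open>The Takiff Lie algebra\<close>

text \<open>The pair \<open>(x\<^sub>0, x\<^sub>1)\<close> stands for the element \<open>x\<^sub>0 \<otimes> 1 + x\<^sub>1 \<otimes> t\<close>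
  of the tensor product of \<open>sl\<^sub>2\<close> with the algebra of polynomials in \<open>t\<close> modulo \<open>t\<^sup>2\<close>.\<close>

type_synonym takiff = "sl2 \<times> sl2"

definition takiff_scale :: "complex \<Rightarrow> takiff \<Rightarrow> takiff"
  where "takiff_scale c x = (sl2_scale c (fst x), sl2_scale c (snd x))"

definition takiff_bracket :: "takiff \<Rightarrow> takiff \<Rightarrow> takiff"
  where "takiff_bracket x y =
    (sl2_bracket (fst x) (fst y), sl2_bracket (fst x) (snd y) + sl2_bracket (snd x) (fst y))"

lemma vector_space_takiff: "vector_space takiff_scale"
  by standard (simp_all add: takiff_scale_def prod_eq_iff sl2_eq_iff distrib_left distrib_right)

lemma lie_algebra_takiff: "lie_algebra takiff_scale takiff_bracket"
proof -
  have "Vector_Spaces.linear takiff_scale takiff_scale (\<lambda>x. takiff_bracket x y)"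
    and "Vector_Spaces.linear takiff_scale takiff_scale (takiff_bracket y)" for y
    using vector_space_takiff
    by (simp_all add: Vector_Spaces.linear_iff takiff_scale_def takiff_bracket_def sl2_eq_iff
        algebra_simps)
  moreover have "takiff_bracket x x = 0" for x
    by (simp add: takiff_bracket_def prod_eq_iff sl2_eq_iff)
  moreover have "takiff_bracket x (takiff_bracket y z) + takiff_bracket y (takiff_bracket z x)
      + takiff_bracket z (takiff_bracket x y) = 0" for x y z
    by (simp add: takiff_bracket_def prod_eq_iff sl2_eq_iff algebra_simps)
  ultimately show ?thesis
    using vector_space_takiff by (simp add: lie_algebra_def lie_algebra_axioms_def)
qed


section \<open>Polynomials in \<open>h\<close> and \<open>hbar\<close>\<close>

text \<open>The ring of polynomials in \<open>h\<close> and \<open>hbar\<close> is \<^typ>\<open>complex poly poly\<close>: the outer variable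
  is \<open>h\<close>, and the coefficients are polynomials in \<open>hbar\<close>. A polynomial \<open>p\<close> in \<open>hbar\<close> alone is
  therefore \<open>[:p:]\<close>, and a complex constant \<open>c\<close> is \<open>[:[:c:]:]\<close>.\<close>

type_synonym hpoly = "complex poly poly"

abbreviation hconst :: "complex \<Rightarrow> hpoly"
  where "hconst c \<equiv> [:[:c:]:]"

abbreviation hvar :: hpoly
  where "hvar \<equiv> [:0, 1:]"

abbreviation hbar :: hpoly
  where "hbar \<equiv> [:[:0, 1:]:]"

definition hscale :: "complex \<Rightarrow> hpoly \<Rightarrow> hpoly"
  where "hscale c \<gamma> = smult [:c:] \<gamma>"

text \<open>\<open>shift c \<gamma>\<close> is \<open>\<gamma>(h + c, hbar)\<close>.\<close>

definition shift :: "complex \<Rightarrow> hpoly \<Rightarrow> hpoly"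
  where "shift c \<gamma> = pcompose \<gamma> (hvar + hconst c)"

text \<open>The partial derivative with respect to \<open>hbar\<close>.\<close>

definition dbar :: "hpoly \<Rightarrow> hpoly"
  where "dbar \<gamma> = map_poly pderiv \<gamma>"


section \<open>The modules\<close>

text \<open>The linear extension of the actions \<open>E, H, F, Eb, Hb, Fb\<close> of the basis elements
  \<open>e, h, f\<close> and \<open>e \<otimes> t, h \<otimes> t, f \<otimes> t\<close>, in this order.\<close>

definition takiff_action ::
    "(hpoly \<Rightarrow> hpoly) \<Rightarrow> (hpoly \<Rightarrow> hpoly) \<Rightarrow> (hpoly \<Rightarrow> hpoly) \<Rightarrow>
     (hpoly \<Rightarrow> hpoly) \<Rightarrow> (hpoly \<Rightarrow> hpoly) \<Rightarrow> (hpoly \<Rightarrow> hpoly) \<Rightarrow>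
     takiff \<Rightarrow> hpoly \<Rightarrow> hpoly"
  where "takiff_action E H F Eb Hb Fb x \<gamma> =
      hscale (coord_e (fst x)) (E \<gamma>) + hscale (coord_h (fst x)) (H \<gamma>)
    + hscale (coord_f (fst x)) (F \<gamma>)
    + hscale (coord_e (snd x)) (Eb \<gamma>) + hscale (coord_h (snd x)) (Hb \<gamma>)
    + hscale (coord_f (snd x)) (Fb \<gamma>)"

lemma takiff_action_basis:
  "takiff_action E H F Eb Hb Fb (sl2_e, 0) = E"
  "takiff_action E H F Eb Hb Fb (sl2_h, 0) = H"
  "takiff_action E H F Eb Hb Fb (sl2_f, 0) = F"
  "takiff_action E H F Eb Hb Fb (0, sl2_e) = Eb"
  "takiff_action E H F Eb Hb Fb (0, sl2_h) = Hb"
  "takiff_action E H F Eb Hb Fb (0, sl2_f) = Fb"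
  by (simp_all add: takiff_action_def hscale_def fun_eq_iff flip: one_pCons)

definition Gamma_act :: "complex \<Rightarrow> complex \<Rightarrow> complex \<Rightarrow> takiff \<Rightarrow> hpoly \<Rightarrow> hpoly"
  where "Gamma_act lam a b = takiff_action
    (\<lambda>\<gamma>. hscale (- 2 * lam) (dbar (shift (-2) \<gamma>)))
    (\<lambda>\<gamma>. hvar * \<gamma>)
    (\<lambda>\<gamma>. hscale (- 1 / (2 * lam)) (((hvar + hconst 2) * hbar + hconst b) * shift 2 \<gamma>)
        - hscale (1 / (2 * lam)) ((hbar ^ 2 + hconst a) * dbar (shift 2 \<gamma>)))
    (\<lambda>\<gamma>. hscale lam (shift (-2) \<gamma>))
    (\<lambda>\<gamma>. hbar * \<gamma>)
    (\<lambda>\<gamma>. hscale (- 1 / (4 * lam)) ((hbar ^ 2 + hconst a) * shift 2 \<gamma>))"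

definition Theta_act :: "complex \<Rightarrow> complex \<Rightarrow> complex \<Rightarrow> takiff \<Rightarrow> hpoly \<Rightarrow> hpoly"
  where "Theta_act lam a b = takiff_action
    (\<lambda>\<gamma>. hscale (- 1 / (2 * lam)) (((hvar - hconst 2) * hbar + hconst b) * shift (-2) \<gamma>)
        + hscale (1 / (2 * lam)) ((hbar ^ 2 + hconst a) * dbar (shift (-2) \<gamma>)))
    (\<lambda>\<gamma>. hvar * \<gamma>)
    (\<lambda>\<gamma>. hscale (2 * lam) (dbar (shift 2 \<gamma>)))
    (\<lambda>\<gamma>. hscale (- 1 / (4 * lam)) ((hbar ^ 2 + hconst a) * shift (-2) \<gamma>))
    (\<lambda>\<gamma>. hbar * \<gamma>)
    (\<lambda>\<gamma>. hscale lam (shift 2 \<gamma>))"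

text \<open>The coefficients of \<open>\<alpha>\<^sub>1\<close> up to index \<open>m\<close> are the same for every upper bound \<open>m\<close> on the
  degree of \<open>\<beta>\<^sub>1\<close>, and they vanish beyond the degree; we take \<open>m\<close> to be the degree.\<close>

definition alpha1 :: "complex \<Rightarrow> complex \<Rightarrow> complex poly \<Rightarrow> complex poly"
  where "alpha1 lam b \<beta> = (\<Sum>i=0..degree \<beta>. monom
    (lam ^ 2 * (coeff \<beta> i + (\<Sum>j=i+1..degree \<beta>. 2 * b ^ (j - i) * coeff \<beta> j))) i)"

definition Omega_act :: "complex \<Rightarrow> complex \<Rightarrow> complex poly \<Rightarrow> takiff \<Rightarrow> hpoly \<Rightarrow> hpoly"
  where "Omega_act lam b \<beta> = takiff_action
    (\<lambda>\<gamma>. (hscale (lam / 2) hvar + [:alpha1 lam b \<beta>:]) * shift (-2) \<gamma>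
        - hscale lam ((hbar + hconst b) * dbar (shift (-2) \<gamma>)))
    (\<lambda>\<gamma>. hvar * \<gamma>)
    (\<lambda>\<gamma>. - (hscale (1 / (2 * lam)) hvar - [:\<beta>:]) * shift 2 \<gamma>
        - hscale (1 / lam) ((hbar - hconst b) * dbar (shift 2 \<gamma>)))
    (\<lambda>\<gamma>. hscale (lam / 2) ((hbar + hconst b) * shift (-2) \<gamma>))
    (\<lambda>\<gamma>. hbar * \<gamma>)
    (\<lambda>\<gamma>. hscale (- 1 / (2 * lam)) ((hbar - hconst b) * shift 2 \<gamma>))"

abbreviation takiff_simple :: "(takiff \<Rightarrow> hpoly \<Rightarrow> hpoly) \<Rightarrow> bool"
  where "takiff_simple act \<equiv> simple_lie_module takiff_scale takiff_bracket hscale act"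

abbreviation takiff_isomorphic ::
    "(takiff \<Rightarrow> hpoly \<Rightarrow> hpoly) \<Rightarrow> (takiff \<Rightarrow> hpoly \<Rightarrow> hpoly) \<Rightarrow> bool"
  where "takiff_isomorphic act act' \<equiv>
    isomorphic_lie_modules takiff_scale takiff_bracket hscale act hscale act'"

end

theory Submission
  imports Defs
begin

text \<open>
  Write \<open>S\<close> for the substitution of \<open>h - 2\<close> for \<open>h\<close> and \<open>D\<close> for the derivative with respect to
  \<open>hbar\<close>. In all three families \<open>h\<close> and \<open>hbar\<close> act by multiplication, and the relations
  \<open>[h, ebar] = 2 ebar\<close>, \<open>[hbar, ebar] = 0\<close>, \<open>[h, e] = 2 e\<close>, \<open>[hbar, e] = 2 ebar\<close> and their
  analogues for \<open>f\<close> force the remaining operators into the shape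
    \<open>ebar = p S\<close>, \<open>e = u S - 2 p D S\<close>, \<open>fbar = q S\<^sup>-\<^sup>1\<close>, \<open>f = v S\<^sup>-\<^sup>1 + 2 q D S\<^sup>-\<^sup>1\<close>,
  where \<open>u\<close> and \<open>v\<close> are polynomials in \<open>h\<close> and \<open>hbar\<close>, and \<open>p\<close> and \<open>q\<close> are polynomials in \<open>hbar\<close>
  in each of the families. The proof therefore treats this general action once, as
  \<open>free_act u p v q\<close>, and reads off the theorem by substituting the parameters.

  The remaining relations reduce to five polynomial identities between \<open>u\<close>, \<open>p\<close>, \<open>v\<close> and \<open>q\<close>
  (\<open>lie_module_free_act\<close>). For \<open>\<Omega>\<close> the one that matters is the vanishing of the term of order zero of
  \<open>[e, f] - h\<close>, which says that \<open>(hbar - b) \<alpha>\<^sub>1\<close> and \<open>\<lambda>\<^sup>2 (hbar + b) \<beta>\<^sub>1\<close> have the same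
  derivative. The given formula for \<open>\<alpha>\<^sub>1\<close> is the polynomial solution of this equation.

  An isomorphism commutes with \<open>h\<close> and \<open>hbar\<close>, so it is multiplication by a polynomial. As it is
  bijective, this polynomial is a nonzero constant, hence two isomorphic actions are equal and their
  parameters \<open>u\<close>, \<open>p\<close>, \<open>v\<close>, \<open>q\<close> agree (\<open>isomorphic_free_act\<close>).

  A submodule is an ideal of the polynomial ring. Applying \<open>p (S - 1)\<close> with \<open>p \<noteq> 0\<close> lowers the
  degree in \<open>h\<close> until a nonzero polynomial \<open>g\<close> in \<open>hbar\<close> alone is left; then \<open>u g - e g = 2 p g'\<close> and
  \<open>f g - v g = 2 q g'\<close> lie in the submodule. If \<open>p\<close> and \<open>q\<close> generate the unit ideal, then \<open>g'\<close>
  lies in the submodule too, and repeated differentiation produces \<open>1\<close> (\<open>simple_free_act\<close>).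
  If \<open>p\<close> and \<open>q\<close> share a root
  \<open>z\<close>, the multiples of \<open>hbar - z\<close> form a proper submodule (\<open>not_simple_free_act\<close>). For \<open>\<Gamma>\<close> and
  \<open>\<Theta>\<close> one of \<open>p\<close> and \<open>q\<close> is a nonzero constant; for \<open>\<Omega>\<close> they are nonzero multiples of
  \<open>hbar + b\<close> and \<open>hbar - b\<close>, which share a root exactly when \<open>b = 0\<close>.
\<close>

section \<open>Shift and derivative on polynomials in two variables\<close>

lemma hscale_eq_mult: "hscale c \<gamma> = hconst c * \<gamma>"
  by (simp add: hscale_def)

lemma vector_space_hscale: "vector_space hscale"
  by standard (simp_all add: hscale_def smult_add_right smult_add_left[symmetric] mult.commute
      flip: one_pCons)

lemma hscale_distribs:
  "hscale c (\<gamma> + \<delta>) = hscale c \<gamma> + hscale c \<delta>" "hscale c (\<gamma> - \<delta>) = hscale c \<gamma> - hscale c \<delta>"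
  "\<gamma> * hscale c \<delta> = hscale c (\<gamma> * \<delta>)"
  by (simp_all add: hscale_def smult_add_right smult_diff_right)

lemma hscale_collect:
  "hscale c \<gamma> * \<delta> = hscale c (\<gamma> * \<delta>)" "2 * hscale c \<gamma> = hscale (2 * c) \<gamma>"
  "[:smult c r:] = hscale c [:r:]" "hscale (- c) \<gamma> = - hscale c \<gamma>"
  "- hscale c \<gamma> * \<delta> = - hscale c (\<gamma> * \<delta>)"
  by (simp_all add: hscale_def numeral_poly flip: smult_minus_left)

lemma shift_simps [simp]:
  "shift c 0 = 0" "shift c 1 = 1"
  "shift c [:r:] = [:r:]"
  "shift c (p + q) = shift c p + shift c q"
  "shift c (p - q) = shift c p - shift c q"
  "shift c (- p) = - shift c p"
  "shift c (p * q) = shift c p * shift c q"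
  "shift c (hscale d p) = hscale d (shift c p)"
  "shift c hvar = hvar + hconst c"
  by (simp_all add: shift_def hscale_def pcompose_add pcompose_diff pcompose_uminus pcompose_mult
      pcompose_smult pcompose_1 pcompose_pCons)

lemma shift_shift [simp]: "shift c (shift d \<gamma>) = shift (c + d) \<gamma>"
  by (simp add: shift_def pcompose_assoc[symmetric] pcompose_pCons add.commute)

lemma shift_zero [simp]: "shift 0 \<gamma> = \<gamma>"
  by (simp add: shift_def)

lemma coeff_dbar: "coeff (dbar \<gamma>) n = pderiv (coeff \<gamma> n)"
  by (simp add: dbar_def coeff_map_poly)

lemma dbar_simps [simp]:
  "dbar 0 = 0" "dbar 1 = 0"
  "dbar [:r:] = [:pderiv r:]"
  "dbar (pCons r \<gamma>) = pCons (pderiv r) (dbar \<gamma>)"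
  "dbar (\<gamma> + \<delta>) = dbar \<gamma> + dbar \<delta>"
  "dbar (\<gamma> - \<delta>) = dbar \<gamma> - dbar \<delta>"
  "dbar (- \<gamma>) = - dbar \<gamma>"
  by (rule poly_eqI; simp add: coeff_dbar coeff_pCons pderiv_add pderiv_diff pderiv_minus
      split: nat.split)+

lemma dbar_smult: "dbar (smult p \<gamma>) = smult (pderiv p) \<gamma> + smult p (dbar \<gamma>)"
  by (rule poly_eqI) (simp add: coeff_dbar pderiv_mult algebra_simps)

lemma dbar_mult [simp]: "dbar (\<gamma> * \<delta>) = dbar \<gamma> * \<delta> + \<gamma> * dbar \<delta>"
  by (induction \<gamma>) (simp_all add: dbar_smult algebra_simps)

lemma dbar_hscale [simp]: "dbar (hscale c \<gamma>) = hscale c (dbar \<gamma>)"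
  by (simp add: hscale_def dbar_smult pderiv_pCons)

lemma shift_dbar [simp]: "shift c (dbar \<gamma>) = dbar (shift c \<gamma>)"
  by (induction \<gamma>) (simp_all add: shift_def pcompose_pCons pderiv_pCons dbar_smult)

text \<open>A polynomial invariant under a nonzero shift takes its value at \<open>0\<close> at all multiples of the
  shift, hence infinitely often.\<close>
lemma degree_eq_0_if_shift_eq:
  assumes "c \<noteq> 0" and eq: "shift c \<gamma> = \<gamma>"
  shows "degree \<gamma> = 0"
proof -
  have "shift (of_nat n * c) \<gamma> = \<gamma>" for n
  proof (induction n)
    case (Suc n)
    then show ?case
      using shift_shift[of c "of_nat n * c" \<gamma>] eq by (simp add: algebra_simps)
  qed simp
  then have "poly (shift (of_nat n * c) \<gamma>) 0 = poly \<gamma> 0" for n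
    by simp
  then have "range (\<lambda>n. [:of_nat n * c:]) \<subseteq> {x. poly (\<gamma> - [:poly \<gamma> 0:]) x = 0}"
    by (auto simp: shift_def poly_pcompose)
  moreover have "infinite (range (\<lambda>n. [:of_nat n * c:]))"
    using assms(1) by (intro range_inj_infinite) (simp add: inj_def)
  ultimately have "\<gamma> - [:poly \<gamma> 0:] = 0"
    using poly_roots_finite finite_subset by blast
  then show ?thesis
    by (metis degree_pCons_0 right_minus_eq)
qed

lemma degree_shift_diff:
  assumes "degree \<gamma> \<noteq> 0"
  shows "degree (shift c \<gamma> - \<gamma>) < degree \<gamma>"
proof -
  have "degree (shift c \<gamma>) = degree \<gamma>"
    by (simp add: shift_def degree_pcompose)
  moreover have "lead_coeff (shift c \<gamma>) = lead_coeff \<gamma>"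
    using lead_coeff_comp[of "hvar + hconst c" \<gamma>] by (simp add: shift_def)
  ultimately have "degree (shift c \<gamma> - \<gamma>) \<le> degree \<gamma>" "coeff (shift c \<gamma> - \<gamma>) (degree \<gamma>) = 0"
    by (auto intro: degree_diff_le)
  then show ?thesis
    using eq_zero_or_degree_less assms by fastforce
qed

text \<open>Facts about ideals and about maps that commute with \<open>h\<close> and \<open>hbar\<close> are proved by this
  induction, since it only refers to the operations that a module action provides.\<close>
lemma hpoly_generated_induct [case_names const add hvar hbar]:
  fixes \<gamma> :: hpoly
  assumes const: "\<And>c. P (hconst c)"
    and add: "\<And>\<gamma> \<delta>. P \<gamma> \<Longrightarrow> P \<delta> \<Longrightarrow> P (\<gamma> + \<delta>)"
    and hvar: "\<And>\<gamma>. P \<gamma> \<Longrightarrow> P (hvar * \<gamma>)" and hbar: "\<And>\<gamma>. P \<gamma> \<Longrightarrow> P (hbar * \<gamma>)"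
  shows "P \<gamma>"
proof (induction \<gamma>)
  case 0
  show ?case using const[of 0] by simp
next
  case (pCons r \<gamma>)
  have "P [:r:]"
  proof (induction r)
    case 0
    show ?case using const[of 0] by simp
  next
    case (pCons c r)
    then show ?case using add[OF const hbar, of "[:r:]" c] by simp
  qed
  then show ?case using add[OF _ hvar, of "[:r:]" \<gamma>] pCons.IH by simp
qed

lemma linear_hscaleI:
  assumes "\<And>\<gamma> \<delta>. T (\<gamma> + \<delta>) = T \<gamma> + T \<delta>" and "\<And>c \<gamma>. T (hscale c \<gamma>) = hscale c (T \<gamma>)"
  shows "Vector_Spaces.linear hscale hscale T"
  using assms vector_space_hscale by (simp add: Vector_Spaces.linear_iff)

section \<open>Takiff actions extending multiplication by h and hbar\<close>

text \<open>Both sides of the bracket identity are bilinear in the Lie algebra elements, so it suffices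
  to know the commutators of the basis. Those that involve \<open>h\<close> or \<open>hbar\<close> are stated as rules
  moving an operator past a multiplication.\<close>
lemma lie_module_takiff_action:
  assumes "\<And>T. T \<in> {E, F, Eb, Fb} \<Longrightarrow> Vector_Spaces.linear hscale hscale T"
    and weight: "\<And>\<gamma>. E (hvar * \<gamma>) = (hvar - 2) * E \<gamma>" "\<And>\<gamma>. F (hvar * \<gamma>) = (hvar + 2) * F \<gamma>"
      "\<And>\<gamma>. Eb (hvar * \<gamma>) = (hvar - 2) * Eb \<gamma>" "\<And>\<gamma>. Fb (hvar * \<gamma>) = (hvar + 2) * Fb \<gamma>"
    and hbar: "\<And>\<gamma>. E (hbar * \<gamma>) = hbar * E \<gamma> - 2 * Eb \<gamma>" "\<And>\<gamma>. F (hbar * \<gamma>) = hbar * F \<gamma> + 2 * Fb \<gamma>"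
      "\<And>\<gamma>. Eb (hbar * \<gamma>) = hbar * Eb \<gamma>" "\<And>\<gamma>. Fb (hbar * \<gamma>) = hbar * Fb \<gamma>"
    and weight_zero: "\<And>\<gamma>. E (F \<gamma>) = F (E \<gamma>) + hvar * \<gamma>"
      "\<And>\<gamma>. E (Fb \<gamma>) = Fb (E \<gamma>) + hbar * \<gamma>"
      "\<And>\<gamma>. Eb (F \<gamma>) = F (Eb \<gamma>) + hbar * \<gamma>"
    and comm: "\<And>\<gamma>. E (Eb \<gamma>) = Eb (E \<gamma>)" "\<And>\<gamma>. F (Fb \<gamma>) = Fb (F \<gamma>)" "\<And>\<gamma>. Eb (Fb \<gamma>) = Fb (Eb \<gamma>)"
  shows "lie_module takiff_scale takiff_bracket hscale
    (takiff_action E (\<lambda>\<gamma>. hvar * \<gamma>) F Eb (\<lambda>\<gamma>. hbar * \<gamma>) Fb)" (is "lie_module _ _ _ ?act")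
proof -
  \<comment> \<open>The simplifier would merge products of explicit polynomials into coefficient lists; opaque
    names keep the computation one in a commutative ring.\<close>
  define X Y :: hpoly where "X = hvar" and "Y = hbar"
  define C where "C = (\<lambda>c. hconst c)"
  have C: "C (x + y) = C x + C y" "C (x - y) = C x - C y" "C (x * y) = C x * C y" "C 2 = 2" for x y
    by (simp_all add: C_def numeral_poly)
  have sc: "hscale c \<gamma> = C c * \<gamma>" for c \<gamma>
    by (simp add: C_def hscale_eq_mult)
  have add: "T (\<gamma> + \<delta>) = T \<gamma> + T \<delta>" and scale: "T (C c * \<gamma>) = C c * T \<gamma>"
    if "T \<in> {E, F, Eb, Fb}" for T c \<gamma> \<delta>
    using assms(1)[OF that] by (simp_all add: Vector_Spaces.linear_iff sc)
  note lin = add[of E, simplified] add[of F, simplified] add[of Eb, simplified] add[of Fb, simplified]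
    scale[of E, simplified] scale[of F, simplified] scale[of Eb, simplified] scale[of Fb, simplified]
  note rel = weight[folded X_def] hbar[folded Y_def] weight_zero[folded X_def Y_def] comm
  define act where "act = ?act"
  have act: "act x \<gamma> = C (coord_e (fst x)) * E \<gamma> + C (coord_h (fst x)) * (X * \<gamma>) + C (coord_f (fst x)) * F \<gamma>
    + C (coord_e (snd x)) * Eb \<gamma> + C (coord_h (snd x)) * (Y * \<gamma>) + C (coord_f (snd x)) * Fb \<gamma>" for x \<gamma>
    by (simp add: act_def takiff_action_def sc X_def Y_def)
  have l: "Vector_Spaces.linear takiff_scale hscale (\<lambda>x. act x v)" for v
    using vector_space_takiff vector_space_hscale
    by (simp add: Vector_Spaces.linear_iff act sc C takiff_scale_def algebra_simps)
  have r: "Vector_Spaces.linear hscale hscale (act x)" for x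
    using vector_space_hscale
    by (simp add: Vector_Spaces.linear_iff act sc lin, simp add: algebra_simps)
  have b: "act (takiff_bracket x y) v = act x (act y v) - act y (act x v)" for x y v
    unfolding act
    by (simp add: takiff_bracket_def lin rel C, simp add: algebra_simps)
  show ?thesis
    unfolding act_def[symmetric] using lie_algebra_takiff vector_space_hscale l r b
    by (simp add: lie_module_def lie_module_axioms_def)
qed

text \<open>The factors \<open>- 2 p\<close> and \<open>2 q\<close> of the derivative are those that \<open>[hbar, e] = 2 ebar\<close> and
  \<open>[hbar, f] = - 2 fbar\<close> dictate.\<close>
definition free_act :: "hpoly \<Rightarrow> complex poly \<Rightarrow> hpoly \<Rightarrow> complex poly \<Rightarrow> takiff \<Rightarrow> hpoly \<Rightarrow> hpoly"
  where "free_act u p v q = takiff_action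
    (\<lambda>\<gamma>. u * shift (-2) \<gamma> - 2 * [:p:] * dbar (shift (-2) \<gamma>))
    (\<lambda>\<gamma>. hvar * \<gamma>)
    (\<lambda>\<gamma>. v * shift 2 \<gamma> + 2 * [:q:] * dbar (shift 2 \<gamma>))
    (\<lambda>\<gamma>. [:p:] * shift (-2) \<gamma>)
    (\<lambda>\<gamma>. hbar * \<gamma>)
    (\<lambda>\<gamma>. [:q:] * shift 2 \<gamma>)"

text \<open>The commutators \<open>[e, ebar]\<close>, \<open>[f, fbar]\<close>, \<open>[e, fbar]\<close> and \<open>[ebar, f]\<close> are polynomials
  times shifts, since their derivative terms cancel; the first four hypotheses give these polynomials
  their required values. The commutator \<open>[e, f]\<close> is a differential
  operator of order at most one: its second-order terms cancel, its first-order terms cancel by the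
  identities for \<open>[e, fbar]\<close> and \<open>[ebar, f]\<close>, and the last hypothesis says that its term of order
  zero is \<open>h\<close>.\<close>
lemma lie_module_free_act:
  assumes e_eb: "[:p:] * (u - shift (-2) u) = 2 * [:p * pderiv p:]"
    and f_fb: "[:q:] * (v - shift 2 v) = - 2 * [:q * pderiv q:]"
    and e_fb: "[:q:] * (u - shift 2 u) = hbar + 2 * [:p * pderiv q:]"
    and eb_f: "[:p:] * (shift (-2) v - v) = hbar + 2 * [:q * pderiv p:]"
    and e_f: "u * shift (-2) v - v * shift 2 u
      = hvar + 2 * [:p:] * dbar (shift (-2) v) + 2 * [:q:] * dbar (shift 2 u)"
  shows "lie_module takiff_scale takiff_bracket hscale (free_act u p v q)"
proof -
  define X Y P Q P' Q' :: hpoly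
    where "X = hvar" and "Y = hbar" and "P = [:p:]" and "Q = [:q:]"
      and "P' = [:pderiv p:]" and "Q' = [:pderiv q:]"
  have two: "hconst 2 = 2" "hconst (- 2) = - 2" "shift c 2 = 2" "dbar 2 = 0" for c
    using shift_simps(4)[of c 1 1] dbar_simps(5)[of 1 1] by (simp_all add: numeral_poly)
  have shiftX: "shift c X = X + hconst c" for c
    unfolding X_def by (rule shift_simps)
  have ops: "shift c Y = Y" "shift c P = P" "shift c Q = Q"
     "dbar Y = 1" "dbar X = 0" "dbar P = P'" "dbar Q = Q'" for c
    by (simp_all add: X_def Y_def P_def Q_def P'_def Q'_def pderiv_pCons one_pCons)
  have PQ: "[:p * pderiv p:] = P * P'" "[:q * pderiv q:] = Q * Q'"
    "[:p * pderiv q:] = P * Q'" "[:q * pderiv p:] = Q * P'"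
    by (simp_all add: P_def P'_def Q_def Q'_def)
  note rel = e_eb[unfolded PQ, folded P_def] f_fb[unfolded PQ, folded Q_def]
    e_fb[unfolded PQ, folded Y_def Q_def] eb_f[unfolded PQ, folded Y_def P_def]
    e_f[folded X_def P_def Q_def]
  note norm = two shiftX ops algebra_simps
  show ?thesis
    unfolding free_act_def X_def[symmetric] Y_def[symmetric] P_def[symmetric] Q_def[symmetric]
  proof (rule lie_module_takiff_action[folded X_def Y_def], goal_cases)
    case (1 T)
    then show ?case
      by (auto intro!: linear_hscaleI simp: hscale_distribs, simp_all add: algebra_simps)
  next
    case (10 \<gamma>)
    \<comment> \<open>The combination of the three identities that yields \<open>[e, f] = h\<close>: the coefficient of
      \<open>dbar \<gamma>\<close> in \<open>[e, f] \<gamma>\<close> is twice the difference of \<open>[e, fbar]\<close> and \<open>[ebar, f]\<close>.\<close>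
    define d where "d = dbar \<gamma>"
    have combination: "L = R"
      if "L - R = (x5 - y5) * \<gamma> + 2 * ((x3 - y3) - (x4 - y4)) * d" and "x5 = y5" "x3 = y3" "x4 = y4"
      for L R x3 y3 x4 y4 x5 y5 :: hpoly
      using that by simp
    show ?case
      by (rule combination[OF _ rel(5) rel(3) rel(4)])
        (simp add: two shiftX ops d_def[symmetric], simp add: algebra_simps)
  next
    case (11 \<gamma>)
    show ?case using rel(3) by (simp add: norm) algebra
  next
    case (12 \<gamma>)
    show ?case using rel(4) by (simp add: norm) algebra
  next
    case (13 \<gamma>)
    show ?case using rel(1) by (simp add: norm) algebra
  next
    case (14 \<gamma>)
    show ?case using rel(2) by (simp add: norm) algebra
  qed (simp_all add: norm)
qed

section \<open>Isomorphisms\<close>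

text \<open>An isomorphism is linear over the polynomial ring, because it commutes with \<open>h\<close> and \<open>hbar\<close>.
  It is therefore multiplication by the image of \<open>1\<close>, which is a unit by surjectivity, hence a
  nonzero constant. So the two actions agree on \<open>1\<close>, where all four parameters can be read off.\<close>
lemma isomorphic_free_act:
  assumes "takiff_isomorphic (free_act u p v q) (free_act u' p' v' q')"
  shows "u = u' \<and> p = p' \<and> v = v' \<and> q = q'"
proof -
  let ?act = "free_act u p v q" and ?act' = "free_act u' p' v' q'"
  obtain \<phi> where lin: "Vector_Spaces.linear hscale hscale \<phi>" and bij: "bij \<phi>"
    and \<phi>: "\<And>x \<gamma>. \<phi> (?act x \<gamma>) = ?act' x (\<phi> \<gamma>)"
    using assms by (auto simp: isomorphic_lie_modules_def)
  have add: "\<phi> (\<gamma> + \<delta>) = \<phi> \<gamma> + \<phi> \<delta>" and scale: "\<phi> (hscale c \<gamma>) = hscale c (\<phi> \<gamma>)" for c \<gamma> \<delta>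
    using lin by (simp_all add: Vector_Spaces.linear_iff)
  have hvar: "\<phi> (hvar * \<gamma>) = hvar * \<phi> \<gamma>" and hbar: "\<phi> (hbar * \<gamma>) = hbar * \<phi> \<gamma>" for \<gamma>
    using \<phi>[of "(sl2_h, 0)" \<gamma>] \<phi>[of "(0, sl2_h)" \<gamma>]
    unfolding free_act_def takiff_action_basis by blast+
  have mult: "\<phi> (\<delta> * \<gamma>) = \<delta> * \<phi> \<gamma>" for \<delta> \<gamma>
    by (induction \<delta> rule: hpoly_generated_induct)
      (simp_all only: distrib_right mult.assoc add scale[unfolded hscale_eq_mult] hvar hbar)
  obtain \<gamma> where "\<phi> \<gamma> = 1"
    using bij by (metis bij_pointE)
  then have "\<phi> 1 dvd 1"
    using mult[of \<gamma> 1] by (metis dvd_triv_right mult.right_neutral)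
  then obtain c where c: "\<phi> 1 = hconst c" "c \<noteq> 0"
    by (auto simp: is_unit_poly_iff dvd_field_iff)
  have "hconst c * ?act x 1 = hconst c * ?act' x 1" for x
  proof -
    have "?act' x (hscale c 1) = hscale c (?act' x 1)"
      using lie_module.act_linear_right[of takiff_scale takiff_bracket hscale ?act'] assms
      by (simp add: isomorphic_lie_modules_def Vector_Spaces.linear_iff)
    then show ?thesis
      using \<phi>[of x 1] mult[of "?act x 1" 1] c
      by (simp add: hscale_eq_mult mult.commute del: mult_pCons_left mult_pCons_right)
  qed
  moreover have "hconst c \<noteq> 0"
    using c by simp
  ultimately have eq: "?act x 1 = ?act' x 1" for x
    using mult_left_cancel by blast
  show ?thesis
    using eq[of "(sl2_e, 0)"] eq[of "(0, sl2_e)"] eq[of "(sl2_f, 0)"] eq[of "(0, sl2_f)"]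
    unfolding free_act_def takiff_action_basis by simp
qed

lemma takiff_isomorphic_refl:
  assumes "lie_module takiff_scale takiff_bracket hscale act"
  shows "takiff_isomorphic act act"
proof -
  have "Vector_Spaces.linear hscale hscale id"
    by (intro linear_hscaleI) simp_all
  then show ?thesis
    using assms unfolding isomorphic_lie_modules_def by (intro conjI exI[of _ id]) auto
qed

section \<open>Simplicity\<close>

text \<open>A submodule is an ideal. In a nonzero one, an element of least degree in \<open>h\<close> is killed by
  \<open>p (S - 1)\<close>, so it is a polynomial in \<open>hbar\<close> alone. Among these, one of least degree has a
  derivative that again lies in the submodule, by the Bezout identity, and so must vanish: the
  submodule contains a nonzero constant.\<close>
lemma simple_free_act:
  assumes M: "lie_module takiff_scale takiff_bracket hscale (free_act u p v q)"
    and p: "p \<noteq> 0" and bezout: "s * p + t * q = 1"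
  shows "takiff_simple (free_act u p v q)"
proof -
  have "W = UNIV" if W: "lie_submodule hscale (free_act u p v q) W" and "W \<noteq> {0}" for W
  proof -
    have sub: "module.subspace hscale W" and act: "\<And>x w. w \<in> W \<Longrightarrow> free_act u p v q x w \<in> W"
      using W by (auto simp: lie_submodule_def)
    interpret hs: vector_space hscale by (rule vector_space_hscale)
    note W0 = hs.subspace_0[OF sub] and Wadd = hs.subspace_add[OF sub] and Wdiff = hs.subspace_diff[OF sub]
      and Wscale = hs.subspace_scale[OF sub]
    note act' = act[unfolded free_act_def, of _ "(sl2_e, 0)"] act[unfolded free_act_def, of _ "(sl2_f, 0)"]
      act[unfolded free_act_def, of _ "(0, sl2_e)"] act[unfolded free_act_def, of _ "(sl2_h, 0)"]
      act[unfolded free_act_def, of _ "(0, sl2_h)"]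
    note Wact = act'[unfolded takiff_action_basis]
    have ideal: "\<delta> * w \<in> W" if "w \<in> W" for \<delta> w
      using that
      by (induction \<delta> rule: hpoly_generated_induct)
        (simp_all only: distrib_right mult.assoc Wadd Wscale[unfolded hscale_eq_mult] Wact)
    obtain w where "w \<in> W" "w \<noteq> 0"
      using \<open>W \<noteq> {0}\<close> W0 by blast
    define \<gamma> where "\<gamma> = arg_min degree (\<lambda>\<gamma>. \<gamma> \<in> W \<and> \<gamma> \<noteq> 0)"
    have \<gamma>: "\<gamma> \<in> W" "\<gamma> \<noteq> 0" and \<gamma>_min: "\<And>\<delta>. \<delta> \<in> W \<Longrightarrow> \<delta> \<noteq> 0 \<Longrightarrow> degree \<gamma> \<le> degree \<delta>"
      using arg_min_nat_lemma[of "\<lambda>\<gamma>. \<gamma> \<in> W \<and> \<gamma> \<noteq> 0" w degree] \<open>w \<in> W\<close> \<open>w \<noteq> 0\<close>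
      by (auto simp: \<gamma>_def)
    have "degree \<gamma> = 0"
    proof (rule ccontr)
      assume "degree \<gamma> \<noteq> 0"
      then have "shift (-2) \<gamma> - \<gamma> \<noteq> 0" "degree (shift (-2) \<gamma> - \<gamma>) < degree \<gamma>"
        using degree_eq_0_if_shift_eq[of "-2" \<gamma>] degree_shift_diff[of \<gamma> "-2"] by auto
      moreover have "[:p:] * (shift (-2) \<gamma> - \<gamma>) \<in> W"
        using Wdiff[OF Wact(3)[OF \<gamma>(1)] ideal[OF \<gamma>(1)]] by (simp only: right_diff_distrib)
      ultimately show False
        using \<gamma>_min[of "[:p:] * (shift (-2) \<gamma> - \<gamma>)"] p by simp
    qed
    then obtain g0 where g0: "[:g0:] \<in> W" "g0 \<noteq> 0"
      using \<gamma> by (metis degree_eq_zeroE pCons_0_0)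
    define g where "g = arg_min degree (\<lambda>g. [:g:] \<in> W \<and> g \<noteq> 0)"
    have g: "[:g:] \<in> W" "g \<noteq> 0" and g_min: "\<And>g'. [:g':] \<in> W \<Longrightarrow> g' \<noteq> 0 \<Longrightarrow> degree g \<le> degree g'"
      using arg_min_nat_lemma[of "\<lambda>g. [:g:] \<in> W \<and> g \<noteq> 0" g0 degree] g0
      by (auto simp: g_def)
    \<comment> \<open>\<open>g\<close> is invariant under shifts, so subtracting multiples of \<open>g\<close> from \<open>e g\<close> and \<open>f g\<close> leaves
      only the derivative terms.\<close>
    have "2 * [:p:] * [:pderiv g:] \<in> W" "2 * [:q:] * [:pderiv g:] \<in> W"
      using Wdiff[OF ideal[OF g(1), of u] Wact(1)[OF g(1)]] Wdiff[OF Wact(2)[OF g(1)] ideal[OF g(1), of v]]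
      by (simp_all)
    from Wadd[OF ideal[OF this(1), of "[:s:]"] ideal[OF this(2), of "[:t:]"]]
    have "2 * ([:s * p + t * q:] * [:pderiv g:]) \<in> W"
      by (simp add: distrib_right distrib_left smult_add_left smult_add_right mult_ac)
    from ideal[OF this, of "hconst (1 / 2)"] have "[:pderiv g:] \<in> W"
      by (simp add: bezout numeral_poly)
    then have "pderiv g = 0"
      using g_min[of "pderiv g"] by (fastforce simp: degree_pderiv pderiv_eq_0_iff)
    then obtain c where c: "g = [:c:]" "c \<noteq> 0"
      using g(2) by (auto simp: pderiv_eq_0_iff elim: degree_eq_zeroE)
    have "\<delta> \<in> W" for \<delta>
      using ideal[OF g(1), of "\<delta> * hconst (1 / c)"] c
      by (simp add: one_pCons[symmetric] mult.assoc del: mult_pCons_left)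
    then show ?thesis by blast
  qed
  then show ?thesis
    using M by (auto simp: simple_lie_module_def intro: exI[of _ 1])
qed

text \<open>Multiples of \<open>d = hbar - z\<close> are preserved by shifts and by multiplications. The derivative of
  such a multiple need not be divisible by \<open>d\<close>, but it only occurs with the factor \<open>p\<close> or \<open>q\<close>.\<close>
lemma not_simple_free_act:
  assumes "poly p z = 0" and "poly q z = 0"
  shows "\<not> takiff_simple (free_act u p v q)"
proof -
  define d where "d = [:[:- z, 1:]:]"
  define W where "W = {\<gamma>. d dvd \<gamma>}"
  have pq: "d dvd [:p:]" "d dvd [:q:]"
    using assms by (simp_all add: d_def poly_eq_0_iff_dvd)
  have shift: "d dvd shift c \<gamma>" if "d dvd \<gamma>" for c \<gamma>
    using that by (auto simp: d_def simp del: mult_pCons_left elim!: dvdE)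
  have "lie_submodule hscale (free_act u p v q) W"
    unfolding lie_submodule_def
  proof (intro conjI allI ballI)
    interpret hs: vector_space hscale by (rule vector_space_hscale)
    show "hs.subspace W"
      by (auto simp: hs.subspace_def W_def hscale_eq_mult simp del: mult_pCons_left)
    show "free_act u p v q x w \<in> W" if "w \<in> W" for x w
    proof -
      have w: "d dvd w"
        using that by (simp add: W_def)
      have "d dvd takiff_action E H F Eb Hb Fb x w"
        if "d dvd E w" "d dvd H w" "d dvd F w" "d dvd Eb w" "d dvd Hb w" "d dvd Fb w" for E H F Eb Hb Fb
        using that unfolding takiff_action_def hscale_eq_mult by (intro dvd_add dvd_mult)
      moreover have "d dvd r * shift c w + 2 * [:k:] * dbar (shift c w)"
        "d dvd r * shift c w - 2 * [:k:] * dbar (shift c w)" if "d dvd [:k:]" for r c k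
        by (intro dvd_add dvd_diff dvd_mult[OF shift[OF w]] dvd_mult2[OF dvd_mult[OF that]])+
      ultimately have "d dvd free_act u p v q x w"
        unfolding free_act_def by (simp only: pq w dvd_mult[OF w] dvd_mult2)
      then show ?thesis by (simp add: W_def)
    qed
  qed
  moreover have "1 \<notin> W"
    by (auto simp: W_def d_def is_unit_const_poly_iff is_unit_poly_iff)
  moreover have "d \<in> W" "d \<noteq> 0"
    by (auto simp: W_def d_def)
  ultimately show ?thesis
    by (auto simp: simple_lie_module_def)
qed

section \<open>The three families\<close>

lemma takiff_action_eq_free_act:
  assumes "\<And>\<gamma>. E \<gamma> = u * shift (-2) \<gamma> - 2 * [:p:] * dbar (shift (-2) \<gamma>)"
    and "\<And>\<gamma>. F \<gamma> = v * shift 2 \<gamma> + 2 * [:q:] * dbar (shift 2 \<gamma>)"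
    and "\<And>\<gamma>. Eb \<gamma> = [:p:] * shift (-2) \<gamma>" and "\<And>\<gamma>. Fb \<gamma> = [:q:] * shift 2 \<gamma>"
  shows "takiff_action E (\<lambda>\<gamma>. hvar * \<gamma>) F Eb (\<lambda>\<gamma>. hbar * \<gamma>) Fb = free_act u p v q"
  unfolding free_act_def assms[abs_def] ..

lemma hbar_square: "hbar ^ 2 + hconst a = [:[:a, 0, 1:]:]"
  by (simp add: power2_eq_square)

lemma Gamma_act_eq_free_act:
  "Gamma_act lam a b = free_act 0 [:lam:]
    (hscale (- 1 / (2 * lam)) ((hvar + hconst 2) * hbar + hconst b)) (smult (- 1 / (4 * lam)) [:a, 0, 1:])"
  unfolding Gamma_act_def hbar_square
  by (rule takiff_action_eq_free_act;
      (simp only: hscale_collect mult.assoc)?; simp add: hscale_def numeral_poly flip: smult_minus_left)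

lemma Theta_act_eq_free_act:
  "Theta_act lam a b = free_act
    (hscale (- 1 / (2 * lam)) ((hvar - hconst 2) * hbar + hconst b)) (smult (- 1 / (4 * lam)) [:a, 0, 1:])
    0 [:lam:]"
  unfolding Theta_act_def hbar_square
  by (rule takiff_action_eq_free_act;
      (simp only: hscale_collect mult.assoc)?; simp add: hscale_def numeral_poly flip: smult_minus_left)

lemma Omega_act_eq_free_act:
  "Omega_act lam b \<beta> = free_act (hscale (lam / 2) hvar + [:alpha1 lam b \<beta>:]) (smult (lam / 2) [:b, 1:])
    (- (hscale (1 / (2 * lam)) hvar - [:\<beta>:])) (smult (- 1 / (2 * lam)) [:- b, 1:])"
  unfolding Omega_act_def
  by (rule takiff_action_eq_free_act;
      (simp only: hscale_collect mult.assoc)?; simp add: hscale_def numeral_poly flip: smult_minus_left)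

lemma lie_module_Gamma_act:
  assumes "lam \<noteq> 0"
  shows "lie_module takiff_scale takiff_bracket hscale (Gamma_act lam a b)"
  unfolding Gamma_act_eq_free_act using assms
  by (intro lie_module_free_act)
    ((simp add: hscale_def shift_def pcompose_pCons pderiv_pCons numeral_poly field_simps;
      simp add: one_pCons)+)

lemma lie_module_Theta_act:
  assumes "lam \<noteq> 0"
  shows "lie_module takiff_scale takiff_bracket hscale (Theta_act lam a b)"
  unfolding Theta_act_eq_free_act using assms
  by (intro lie_module_free_act)
    ((simp add: hscale_def shift_def pcompose_pCons pderiv_pCons numeral_poly field_simps;
      simp add: one_pCons)+)

lemma coeff_synthetic_div:
  fixes c :: "'a::comm_semiring_1"
  shows "degree p \<le> n \<Longrightarrow> coeff (synthetic_div p c) i = (\<Sum>j=i+1..n. c ^ (j - Suc i) * coeff p j)"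
proof (induction p arbitrary: i n)
  case (pCons a p)
  show ?case
  proof (cases "p = 0")
    case True
    then show ?thesis
      by (auto simp: coeff_pCons intro!: sum.neutral split: nat.split)
  next
    case False
    then obtain m where n: "n = Suc m" "degree p \<le> m"
      using pCons.prems by (auto simp: Suc_le_eq elim: less_natE)
    have poly_c: "poly p c = (\<Sum>j=0..m. c ^ j * coeff p j)"
      unfolding poly_altdef
      by (rule sum.mono_neutral_cong_left) (use n(2) in \<open>auto simp: coeff_eq_0 mult.commute\<close>)
    have "(\<Sum>j=i+1..n. c ^ (j - Suc i) * coeff (pCons a p) j) = (\<Sum>j=i..m. c ^ (j - i) * coeff p j)"
      unfolding n(1) Suc_eq_plus1[symmetric] sum.shift_bounds_cl_Suc_ivl by simp
    then show ?thesis
      using pCons.IH[OF n(2)] n(2)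
      by (cases i) (simp_all add: poly_c)
  qed
qed simp

text \<open>Written without coefficients, \<open>\<alpha>\<^sub>1 = \<lambda>\<^sup>2 (\<beta>\<^sub>1 + 2 b (\<beta>\<^sub>1 - \<beta>\<^sub>1(b)) / (hbar - b))\<close>.\<close>
lemma alpha1_eq: "alpha1 lam b \<beta> = smult (lam ^ 2) (\<beta> + smult (2 * b) (synthetic_div \<beta> b))"
proof (rule poly_eqI)
  fix i
  have "(\<Sum>j=i+1..degree \<beta>. 2 * b ^ (j - i) * coeff \<beta> j)
      = 2 * b * (\<Sum>j=i+1..degree \<beta>. b ^ (j - Suc i) * coeff \<beta> j)"
    unfolding sum_distrib_left
    by (rule sum.cong) (auto simp: Suc_diff_Suc simp flip: power_Suc)
  then have tail: "(\<Sum>j=i+1..degree \<beta>. 2 * b ^ (j - i) * coeff \<beta> j) = 2 * b * coeff (synthetic_div \<beta> b) i"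
    by (simp only: coeff_synthetic_div[OF order_refl])
  show "coeff (alpha1 lam b \<beta>) i = coeff (smult (lam ^ 2) (\<beta> + smult (2 * b) (synthetic_div \<beta> b))) i"
    unfolding coeff_smult coeff_add tail[symmetric]
    by (auto simp: alpha1_def coeff_sum coeff_eq_0)
qed

text \<open>The formula for \<open>\<alpha>\<^sub>1\<close> makes \<open>(hbar - b) \<alpha>\<^sub>1\<close> and \<open>\<lambda>\<^sup>2 (hbar + b) \<beta>\<^sub>1\<close> differ by a constant.
  Differentiating gives the identity that the relation \<open>[e, f] = h\<close> requires of \<open>\<Omega>\<close>.\<close>
lemma alpha1_differential_equation:
  "alpha1 lam b \<beta> + [:- b, 1:] * pderiv (alpha1 lam b \<beta>)
    = smult (lam ^ 2) (\<beta> + [:b, 1:] * pderiv \<beta>)"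
proof -
  define s c where "s = synthetic_div \<beta> b" and "c = poly \<beta> b"
  have s: "[:- b, 1:] * s = \<beta> - [:c:]"
    unfolding s_def c_def by (subst (2) synthetic_div_correct'[of b \<beta>, symmetric]) simp
  have "[:- b, 1:] * (\<beta> + smult (2 * b) s) = [:- b, 1:] * \<beta> + smult (2 * b) (\<beta> - [:c:])"
    unfolding distrib_left mult_smult_right s ..
  also have "\<dots> = [:- b, 1:] * \<beta> + [:2 * b:] * \<beta> - [:2 * b * c:]"
    by (simp add: smult_diff_right)
  also have "\<dots> = [:b, 1:] * \<beta> - [:2 * b * c:]"
    unfolding distrib_right[symmetric] by simp
  finally have "[:- b, 1:] * alpha1 lam b \<beta> = smult (lam ^ 2) ([:b, 1:] * \<beta> - [:2 * b * c:])"
    unfolding alpha1_eq s_def[symmetric] mult_smult_right by simp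
  then have "pderiv ([:- b, 1:] * alpha1 lam b \<beta>)
      = pderiv (smult (lam ^ 2) ([:b, 1:] * \<beta> - [:2 * b * c:]))"
    by simp
  then show ?thesis
    unfolding pderiv_mult pderiv_smult pderiv_diff
    by (simp add: pderiv_pCons flip: one_pCons) (simp add: algebra_simps)
qed

text \<open>The shift-invariant terms \<open>\<alpha>\<^sub>1\<close> and \<open>\<beta>\<^sub>1\<close> cancel from the differences of \<open>u\<close> or \<open>v\<close> with their
  shifts, so they enter the identity for \<open>[e, f]\<close> alone. There the terms without \<open>h\<close> form the
  differential equation above.\<close>
lemma lie_module_Omega_act:
  assumes "lam \<noteq> 0"
  shows "lie_module takiff_scale takiff_bracket hscale (Omega_act lam b \<beta>)"
proof -
  define X Y B M K A A' G G' :: hpoly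
    where "X = hvar" and "Y = hbar" and "B = hconst b" and "M = hconst (lam / 2)"
      and "K = hconst (1 / (2 * lam))" and "A = [:alpha1 lam b \<beta>:]" and "A' = [:pderiv (alpha1 lam b \<beta>):]"
      and "G = [:\<beta>:]" and "G' = [:pderiv \<beta>:]"
  have MK: "4 * M * K = 1"
    using assms by (simp add: M_def K_def numeral_poly one_pCons)
  have two: "hconst 2 = 2" "hconst (- 2) = - 2" "dbar 2 = 0"
    using dbar_simps(5)[of 1 1] by (simp_all add: numeral_poly)
  have shiftX: "shift c X = X + hconst c" for c
    unfolding X_def by (rule shift_simps)
  have ops: "shift c A = A" "shift c G = G" "shift c M = M" "shift c K = K"
    "dbar X = 0" "dbar A = A'" "dbar G = G'" "dbar M = 0" "dbar K = 0" for c
    by (simp_all add: X_def A_def A'_def G_def G'_def M_def K_def pderiv_pCons)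
  have "[:smult (1 / (2 * lam)) (alpha1 lam b \<beta> + [:- b, 1:] * pderiv (alpha1 lam b \<beta>)):]
      = [:smult (1 / (2 * lam)) (smult (lam ^ 2) (\<beta> + [:b, 1:] * pderiv \<beta>)):]"
    unfolding alpha1_differential_equation ..
  also have "\<dots> = [:smult (lam / 2) (\<beta> + [:b, 1:] * pderiv \<beta>):]"
    using assms by (simp add: power2_eq_square)
  finally have ode: "K * (A + (Y - B) * A') = M * (G + (Y + B) * G')"
    unfolding A_def A'_def G_def G'_def M_def K_def Y_def B_def by simp
  define p q where "p = smult (lam / 2) [:b, 1:]" and "q = smult (- 1 / (2 * lam)) [:- b, 1:]"
  have pq: "[:p:] = M * (Y + B)" "[:q:] = - K * (Y - B)"
    and derivs: "[:p * pderiv p:] = [:p:] * M" "[:q * pderiv q:] = [:q:] * - K"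
      "[:p * pderiv q:] = [:p:] * - K" "[:q * pderiv p:] = [:q:] * M"
    by (simp_all add: p_def q_def M_def K_def Y_def B_def pderiv_smult pderiv_pCons)
  have hvar_multiples: "hscale (lam / 2) hvar = M * X" "hscale (1 / (2 * lam)) hvar = K * X"
    by (simp_all only: hscale_eq_mult M_def K_def X_def)
  show ?thesis
    unfolding Omega_act_eq_free_act p_def[symmetric] q_def[symmetric] hvar_multiples
      A_def[symmetric] G_def[symmetric]
  proof (rule lie_module_free_act, unfold derivs pq Y_def[symmetric] X_def[symmetric], goal_cases)
    case 1
    show ?case by (simp add: shiftX ops two algebra_simps)
  next
    case 2
    show ?case by (simp add: shiftX ops two algebra_simps)
  next
    case 3
    show ?case using MK by (simp add: shiftX ops two) algebra
  next
    case 4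
    show ?case using MK by (simp add: shiftX ops two) algebra
  next
    case 5
    show ?case using MK ode by (simp add: shiftX ops two) algebra
  qed
qed

theorem theorem1p2:
  fixes lam a b lam' a' b' :: complex and \<beta> \<beta>' :: "complex poly"
  assumes "lam \<noteq> 0" and "lam' \<noteq> 0"
  shows "(takiff_simple (Gamma_act lam a b)
      \<and> takiff_simple (Theta_act lam a b)
      \<and> (takiff_isomorphic (Gamma_act lam a b) (Gamma_act lam' a' b')
           \<longleftrightarrow> lam = lam' \<and> a = a' \<and> b = b')
      \<and> (takiff_isomorphic (Theta_act lam a b) (Theta_act lam' a' b')
           \<longleftrightarrow> lam = lam' \<and> a = a' \<and> b = b'))
    \<and> ((takiff_simple (Omega_act lam b \<beta>) \<longleftrightarrow> b \<noteq> 0)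
      \<and> (takiff_isomorphic (Omega_act lam b \<beta>) (Omega_act lam' b' \<beta>')
           \<longleftrightarrow> lam = lam' \<and> b = b' \<and> \<beta> = \<beta>'))"
proof (intro conjI)
  note modules = lie_module_Gamma_act[OF assms(1)] lie_module_Theta_act[OF assms(1)]
    lie_module_Omega_act[OF assms(1)]
  note refl = modules[THEN takiff_isomorphic_refl]
  show "takiff_simple (Gamma_act lam a b)"
    using assms(1) modules(1)[of a b] unfolding Gamma_act_eq_free_act
    by (intro simple_free_act[where s = "[:1 / lam:]" and t = 0]) (simp_all add: one_pCons)
  show "takiff_simple (Theta_act lam a b)"
    using assms(1) modules(2)[of a b] unfolding Theta_act_eq_free_act
    by (intro simple_free_act[where s = 0 and t = "[:1 / lam:]"]) (simp_all add: one_pCons)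
  show "takiff_isomorphic (Gamma_act lam a b) (Gamma_act lam' a' b')
      \<longleftrightarrow> lam = lam' \<and> a = a' \<and> b = b'"
  proof
    assume "takiff_isomorphic (Gamma_act lam a b) (Gamma_act lam' a' b')"
    from isomorphic_free_act[OF this[unfolded Gamma_act_eq_free_act]] assms
    show "lam = lam' \<and> a = a' \<and> b = b'"
      by (auto simp: hscale_def)
  qed (use refl in auto)
  show "takiff_isomorphic (Theta_act lam a b) (Theta_act lam' a' b')
      \<longleftrightarrow> lam = lam' \<and> a = a' \<and> b = b'"
  proof
    assume "takiff_isomorphic (Theta_act lam a b) (Theta_act lam' a' b')"
    from isomorphic_free_act[OF this[unfolded Theta_act_eq_free_act]] assms
    show "lam = lam' \<and> a = a' \<and> b = b'"
      by (auto simp: hscale_def)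
  qed (use refl in auto)
  show "takiff_simple (Omega_act lam b \<beta>) \<longleftrightarrow> b \<noteq> 0"
  proof
    assume "takiff_simple (Omega_act lam b \<beta>)"
    then show "b \<noteq> 0"
      using not_simple_free_act[of "smult (lam / 2) [:b, 1:]" 0 "smult (- 1 / (2 * lam)) [:- b, 1:]"]
      unfolding Omega_act_eq_free_act by auto
  next
    assume "b \<noteq> 0"
    \<comment> \<open>The Bezout identity is a multiple of \<open>(hbar + b) - (hbar - b) = 2 b\<close>.\<close>
    then show "takiff_simple (Omega_act lam b \<beta>)"
      using assms(1) modules(3)[of b \<beta>] unfolding Omega_act_eq_free_act
      by (intro simple_free_act[where s = "[:1 / (lam * b):]" and t = "[:lam / b:]"])
        (simp_all add: one_pCons field_simps)
  qed
  show "takiff_isomorphic (Omega_act lam b \<beta>) (Omega_act lam' b' \<beta>')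
      \<longleftrightarrow> lam = lam' \<and> b = b' \<and> \<beta> = \<beta>'"
  proof
    assume "takiff_isomorphic (Omega_act lam b \<beta>) (Omega_act lam' b' \<beta>')"
    from isomorphic_free_act[OF this[unfolded Omega_act_eq_free_act]] assms
    show "lam = lam' \<and> b = b' \<and> \<beta> = \<beta>'"
      by (auto simp: hscale_def)
  qed (use refl in auto)
qed

end
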